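(* Let $\gamma>0$ and let $T$ be the rank-one operator on $\mathcal{H}_\gamma(\mathbb{D})$ given by $T(f)=\langle f,z\rangle z$ for $f\in\mathcal{H}_\gamma(\mathbb{D})$, where $z$ denotes the identity function. Then $$\mathrm{Ber}(T)=\left[0,\ \frac{\gamma^\gamma}{(1+\gamma)^{1+\gamma}}\right],$$ which is convex in $\mathbb{C}$.
   Context: $\mathbb{D}$ is the open unit disc in $\mathbb{C}$. For $\gamma>0$, $\mathcal{H}_\gamma(\mathbb{D})$ is the reproducing kernel Hilbert space of holomorphic functions on $\mathbb{D}$ with reproducing kernel $k_\lambda(z)=(1-\overline{\lambda}z)^{-\gamma}$ for $\lambda,z\in\mathbb{D}$ (principal branch), so $\langle f,k_\lambda\rangle=f(\lambda)$ and $\|k_\lambda\|^2=(1-|\lambda|^2)^{-\gamma}$. Put $\widehat{k}_\lambda=k_\lambda/\|k_\lambda\|$. For a bounded linear operator $T$ on $\mathcal{H}_\gamma(\mathbb{D})$, the Berezin transform is $\widetilde{T}(\lambda)=\langle T\widehat{k}_\lambda,\widehat{k}_\lambda\rangle$ for $\lambda\in\mathbb{D}$, and the Berezin range is $\mathrm{Ber}(T)=\{\widetilde{T}(\lambda):\lambda\in\mathbb{D}\}\subseteq\mathbb{C}$. *)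

theory Defs
  imports "HOL-Complex_Analysis.Complex_Analysis"
begin

text \<open>
  A complex-valued function on a set \<open>X\<close> is represented by the total function that vanishes
  outside \<open>X\<close>. Equality of representatives is then equality on \<open>X\<close>, and the linear operations
  are the pointwise ones. An inner product is a function \<open>ip\<close> of which only the values on the
  space \<open>H\<close> matter; it is linear in the first and conjugate-linear in the second argument.
\<close>

definition ip_norm :: "(('a \<Rightarrow> complex) \<Rightarrow> ('a \<Rightarrow> complex) \<Rightarrow> complex) \<Rightarrow> ('a \<Rightarrow> complex) \<Rightarrow> real"
  where "ip_norm ip f = sqrt (Re (ip f f))"

locale function_hilbert_space =
  fixes X :: "'a set"
    and H :: "('a \<Rightarrow> complex) set"
    and ip :: "('a \<Rightarrow> complex) \<Rightarrow> ('a \<Rightarrow> complex) \<Rightarrow> complex"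
  assumes vanish_outside: "\<And>f x. f \<in> H \<Longrightarrow> x \<notin> X \<Longrightarrow> f x = 0"
    and zero_mem: "(\<lambda>x. 0) \<in> H"
    and add_mem: "\<And>f g. f \<in> H \<Longrightarrow> g \<in> H \<Longrightarrow> (\<lambda>x. f x + g x) \<in> H"
    and scale_mem: "\<And>c f. f \<in> H \<Longrightarrow> (\<lambda>x. c * f x) \<in> H"
    and ip_add: "\<And>f g h. f \<in> H \<Longrightarrow> g \<in> H \<Longrightarrow> h \<in> H \<Longrightarrow>
                   ip (\<lambda>x. f x + g x) h = ip f h + ip g h"
    and ip_scale: "\<And>c f g. f \<in> H \<Longrightarrow> g \<in> H \<Longrightarrow> ip (\<lambda>x. c * f x) g = c * ip f g"
    and ip_cnj: "\<And>f g. f \<in> H \<Longrightarrow> g \<in> H \<Longrightarrow> ip g f = cnj (ip f g)"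
    and ip_pos: "\<And>f. f \<in> H \<Longrightarrow> f \<noteq> (\<lambda>x. 0) \<Longrightarrow> 0 < Re (ip f f)"
    and complete: "\<And>F :: nat \<Rightarrow> 'a \<Rightarrow> complex.
        (\<And>n. F n \<in> H) \<Longrightarrow>
        (\<And>e. e > 0 \<Longrightarrow> \<exists>N. \<forall>m\<ge>N. \<forall>n\<ge>N. ip_norm ip (\<lambda>x. F m x - F n x) < e) \<Longrightarrow>
        \<exists>f\<in>H. (\<lambda>n. ip_norm ip (\<lambda>x. F n x - f x)) \<longlonglongrightarrow> 0"

text \<open>The kernel is curried as \<open>k l x\<close>, i.e. \<open>k l\<close> is the kernel function at the point \<open>l\<close>.\<close>

locale rkhs = function_hilbert_space X H ip
  for X :: "'a set" and k :: "'a \<Rightarrow> 'a \<Rightarrow> complex"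
    and H :: "('a \<Rightarrow> complex) set"
    and ip :: "('a \<Rightarrow> complex) \<Rightarrow> ('a \<Rightarrow> complex) \<Rightarrow> complex" +
  assumes kernel_mem: "\<And>l. l \<in> X \<Longrightarrow> k l \<in> H"
    and reproducing: "\<And>f l. f \<in> H \<Longrightarrow> l \<in> X \<Longrightarrow> ip f (k l) = f l"

definition bounded_operator_on ::
    "('a \<Rightarrow> complex) set \<Rightarrow> (('a \<Rightarrow> complex) \<Rightarrow> ('a \<Rightarrow> complex) \<Rightarrow> complex)
      \<Rightarrow> (('a \<Rightarrow> complex) \<Rightarrow> ('a \<Rightarrow> complex)) \<Rightarrow> bool"
  where "bounded_operator_on H ip T \<longleftrightarrow>
    (\<forall>f\<in>H. T f \<in> H) \<and>
    (\<forall>f\<in>H. \<forall>g\<in>H. T (\<lambda>x. f x + g x) = (\<lambda>x. T f x + T g x)) \<and>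
    (\<forall>c. \<forall>f\<in>H. T (\<lambda>x. c * f x) = (\<lambda>x. c * T f x)) \<and>
    (\<exists>C. \<forall>f\<in>H. ip_norm ip (T f) \<le> C * ip_norm ip f)"

definition normalized_kernel ::
    "(('a \<Rightarrow> complex) \<Rightarrow> ('a \<Rightarrow> complex) \<Rightarrow> complex) \<Rightarrow> ('a \<Rightarrow> 'a \<Rightarrow> complex) \<Rightarrow> 'a \<Rightarrow> 'a \<Rightarrow> complex"
  where "normalized_kernel ip k l = (\<lambda>x. k l x / complex_of_real (ip_norm ip (k l)))"

definition berezin_transform ::
    "(('a \<Rightarrow> complex) \<Rightarrow> ('a \<Rightarrow> complex) \<Rightarrow> complex) \<Rightarrow> ('a \<Rightarrow> 'a \<Rightarrow> complex)
      \<Rightarrow> (('a \<Rightarrow> complex) \<Rightarrow> ('a \<Rightarrow> complex)) \<Rightarrow> 'a \<Rightarrow> complex"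
  where "berezin_transform ip k T l = ip (T (normalized_kernel ip k l)) (normalized_kernel ip k l)"

definition berezin_range ::
    "'a set \<Rightarrow> (('a \<Rightarrow> complex) \<Rightarrow> ('a \<Rightarrow> complex) \<Rightarrow> complex) \<Rightarrow> ('a \<Rightarrow> 'a \<Rightarrow> complex)
      \<Rightarrow> (('a \<Rightarrow> complex) \<Rightarrow> ('a \<Rightarrow> complex)) \<Rightarrow> complex set"
  where "berezin_range X ip k T = berezin_transform ip k T ` X"

definition rank_one ::
    "(('a \<Rightarrow> complex) \<Rightarrow> ('a \<Rightarrow> complex) \<Rightarrow> complex) \<Rightarrow> ('a \<Rightarrow> complex) \<Rightarrow> ('a \<Rightarrow> complex)
      \<Rightarrow> ('a \<Rightarrow> complex) \<Rightarrow> ('a \<Rightarrow> complex)"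
  where "rank_one ip g h = (\<lambda>f x. ip f h * g x)"

abbreviation unit_disc :: "complex set"
  where "unit_disc \<equiv> ball 0 1"

definition disc_kernel :: "real \<Rightarrow> complex \<Rightarrow> complex \<Rightarrow> complex"
  where "disc_kernel \<gamma> l = (\<lambda>z. if z \<in> unit_disc
           then (1 - cnj l * z) powr (- complex_of_real \<gamma>) else 0)"

definition disc_id :: "complex \<Rightarrow> complex"
  where "disc_id = (\<lambda>z. if z \<in> unit_disc then z else 0)"

text \<open>
  A reproducing kernel Hilbert space is determined by its kernel, so this predicate says that
  \<open>H\<close> with the inner product \<open>ip\<close> is the space \<open>H\<^sub>\<gamma>\<close> on the disc. The values of \<open>ip\<close> outside \<open>H\<close>
  remain unspecified.
\<close>

definition is_H_gamma ::
    "real \<Rightarrow> (complex \<Rightarrow> complex) set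
      \<Rightarrow> ((complex \<Rightarrow> complex) \<Rightarrow> (complex \<Rightarrow> complex) \<Rightarrow> complex) \<Rightarrow> bool"
  where "is_H_gamma \<gamma> H ip \<longleftrightarrow>
    rkhs unit_disc (disc_kernel \<gamma>) H ip \<and> (\<forall>f\<in>H. f holomorphic_on unit_disc)"

end

theory Submission imports Defs begin

text \<open>
  The difference quotients \<open>(k\<^sub>h - k\<^sub>0) / h\<close> at real \<open>h\<close> have inner products \<open>\<phi> (h * g)\<close> with
  \<open>\<phi> t = ((1 - t) powr - \<gamma> - 1) / t\<close>. Since \<open>\<phi>\<close> tends to \<open>\<gamma>\<close> at \<open>0\<close>, they form a Cauchy sequence as
  \<open>h\<close> tends to \<open>0\<close>, whose limit is \<open>\<gamma> z\<close>; hence \<open>z\<close> lies in the space. By the reproducing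
  property the Berezin transform of the operator is \<open>t (1 - t) powr \<gamma>\<close> with \<open>t = |\<lambda>|\<^sup>2\<close>, whose
  maximum on \<open>[0, 1)\<close> is attained at \<open>t = 1 / (1 + \<gamma>)\<close>.
\<close>

section \<open>Inner product algebra, Cauchy-Schwarz and boundedness of rank-one operators\<close>

context function_hilbert_space
begin

lemma diff_mem: "f \<in> H \<Longrightarrow> g \<in> H \<Longrightarrow> (\<lambda>x. f x - g x) \<in> H"
  using add_mem[of f "\<lambda>x. (-1) * g x"] scale_mem[of g "-1"] by simp

lemma ip_zero_left: "f \<in> H \<Longrightarrow> ip (\<lambda>x. 0) f = 0"
  using ip_scale[of f f 0] by simp

lemma ip_diff_left:
  "f \<in> H \<Longrightarrow> g \<in> H \<Longrightarrow> h \<in> H \<Longrightarrow> ip (\<lambda>x. f x - g x) h = ip f h - ip g h"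
  using ip_add[of f "\<lambda>x. (-1) * g x" h] scale_mem[of g "-1"] ip_scale[of g h "-1"] by simp

lemma ip_diff_right:
  assumes "f \<in> H" "g \<in> H" "h \<in> H"
  shows "ip h (\<lambda>x. f x - g x) = ip h f - ip h g"
  using assms ip_diff_left[of f g h]
  by (metis complex_cnj_diff diff_mem ip_cnj)

lemma ip_scale_right:
  assumes "f \<in> H" "g \<in> H"
  shows "ip f (\<lambda>x. c * g x) = cnj c * ip f g"
  using assms ip_scale[of g f c]
  by (metis complex_cnj_mult ip_cnj scale_mem)

lemma ip_self_nonneg: "f \<in> H \<Longrightarrow> 0 \<le> Re (ip f f)"
  using ip_pos[of f] ip_zero_left[of f] by (cases "f = (\<lambda>x. 0)") force+

lemma ip_self_real: "f \<in> H \<Longrightarrow> ip f f = complex_of_real (Re (ip f f))"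
  using ip_cnj[of f f] by (simp add: complex_eq_iff)

lemma ip_norm_power2: "f \<in> H \<Longrightarrow> (ip_norm ip f)\<^sup>2 = Re (ip f f)"
  by (simp add: ip_norm_def ip_self_nonneg)

lemma ip_norm_nonneg: "f \<in> H \<Longrightarrow> 0 \<le> ip_norm ip f"
  by (simp add: ip_norm_def ip_self_nonneg)

lemma ip_norm_scale:
  assumes "f \<in> H"
  shows "ip_norm ip (\<lambda>x. c * f x) = cmod c * ip_norm ip f"
proof -
  have "ip (\<lambda>x. c * f x) (\<lambda>x. c * f x) = (c * cnj c) * ip f f"
    using assms by (simp add: ip_scale ip_scale_right scale_mem)
  also have "\<dots> = complex_of_real ((cmod c)\<^sup>2 * Re (ip f f))"
    using ip_self_real[OF assms] by (metis complex_norm_square of_real_mult)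
  finally show ?thesis
    by (simp add: ip_norm_def real_sqrt_mult)
qed

lemma Cauchy_Schwarz:
  assumes f: "f \<in> H" and g: "g \<in> H"
  shows "cmod (ip f g) \<le> ip_norm ip f * ip_norm ip g"
proof (cases "g = (\<lambda>x. 0)")
  case True
  then have "ip f g = 0"
    using ip_cnj[OF g f] ip_zero_left[OF f] by simp
  then show ?thesis
    using f g by (simp add: ip_norm_nonneg)
next
  case False
  define a b s where "a = Re (ip f f)" and "b = Re (ip g g)" and "s = ip f g"
  have b: "b > 0"
    using ip_pos[OF g False] by (simp add: b_def)
  \<comment> \<open>\<open>c\<close> is the coefficient of the orthogonal projection of
    \<open>f\<close> onto the line through \<open>g\<close>; the squared norm of the remainder,
    \<open>a - |s|^2 / b\<close>, is nonnegative.\<close>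
  define c where "c = s / of_real b"
  have cg: "(\<lambda>x. c * g x) \<in> H"
    using g by (rule scale_mem)
  have "ip (\<lambda>x. f x - c * g x) (\<lambda>x. f x - c * g x)
      = ip f f - cnj c * s - c * cnj s + c * cnj c * ip g g"
    using f g cg ip_cnj[OF f g]
    by (simp add: ip_diff_left ip_diff_right diff_mem ip_scale ip_scale_right s_def algebra_simps)
  also have "\<dots> = of_real a - cnj c * s - c * cnj s + c * cnj c * of_real b"
    using ip_self_real[OF f] ip_self_real[OF g] by (simp add: a_def b_def)
  also have "\<dots> = of_real a - s * cnj s / of_real b"
    using b by (simp add: c_def field_simps)
  also have "\<dots> = of_real (a - (cmod s)\<^sup>2 / b)"
    unfolding of_real_diff of_real_divide complex_norm_square ..
  finally have "0 \<le> a - (cmod s)\<^sup>2 / b"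
    using ip_self_nonneg[OF diff_mem[OF f cg]] by simp
  then have "(cmod s)\<^sup>2 \<le> a * b"
    using b by (simp add: field_simps)
  then have "(cmod s)\<^sup>2 \<le> (ip_norm ip f * ip_norm ip g)\<^sup>2"
    using f g by (simp add: power_mult_distrib ip_norm_power2 a_def b_def)
  then show ?thesis
    unfolding s_def by (rule power2_le_imp_le) (use f g in \<open>simp add: ip_norm_nonneg\<close>)
qed

lemma bounded_operator_rank_one:
  assumes g: "g \<in> H" and h: "h \<in> H"
  shows "bounded_operator_on H ip (rank_one ip g h)"
  unfolding bounded_operator_on_def rank_one_def
proof (intro conjI ballI allI exI)
  fix f assume f: "f \<in> H"
  show "(\<lambda>x. ip f h * g x) \<in> H"
    using g by (rule scale_mem)
  show "(\<lambda>x. ip (\<lambda>x. c * f x) h * g x) = (\<lambda>x. c * (ip f h * g x))" for c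
    using f h by (simp add: ip_scale mult.assoc)
  show "(\<lambda>x. ip (\<lambda>x. f x + f' x) h * g x) = (\<lambda>x. ip f h * g x + ip f' h * g x)"
    if "f' \<in> H" for f'
    using f h that by (simp add: ip_add distrib_right)
  \<comment> \<open>This fixes the bound left schematic by \<open>exI\<close>: Cauchy-Schwarz gives
    the product of the norms of \<open>h\<close> and \<open>g\<close>.\<close>
  show "ip_norm ip (\<lambda>x. ip f h * g x) \<le> (ip_norm ip h * ip_norm ip g) * ip_norm ip f"
    using mult_right_mono[OF Cauchy_Schwarz[OF f h] ip_norm_nonneg[OF g]]
    unfolding ip_norm_scale[OF g] by (simp only: mult_ac)
qed

end

section \<open>Consequences of the reproducing property\<close>

context rkhs
begin

text \<open>Evaluation at \<open>l\<close> is the inner product with \<open>k l\<close>, so by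
  Cauchy-Schwarz it is at most a constant times the norm.\<close>

lemma norm_convergence_imp_pointwise:
  assumes F: "\<And>n. F n \<in> H" and f: "f \<in> H" and l: "l \<in> X"
    and lim: "(\<lambda>n. ip_norm ip (\<lambda>x. F n x - f x)) \<longlonglongrightarrow> 0"
  shows "(\<lambda>n. F n l) \<longlonglongrightarrow> f l"
proof -
  have bound: "cmod (F n l - f l) \<le> ip_norm ip (\<lambda>x. F n x - f x) * ip_norm ip (k l)" for n
    using Cauchy_Schwarz[OF diff_mem[OF F f] kernel_mem[OF l], of n]
      reproducing[OF diff_mem[OF F f] l, of n] by simp
  have "(\<lambda>n. F n l - f l) \<longlonglongrightarrow> 0"
    by (rule Lim_null_comparison[OF always_eventually tendsto_mult_left_zero[OF lim]])
      (rule allI, rule bound)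
  then show ?thesis
    by (simp add: LIM_zero_iff)
qed

text \<open>With \<open>n\<close> the normalized kernel, the transform is
  \<open>ip n g * ip g n\<close>, the squared modulus of \<open>ip g n\<close>; by reproduction
  \<open>ip g n\<close> is \<open>g l\<close> over the norm of \<open>k l\<close>.\<close>

lemma berezin_transform_rank_one:
  assumes g: "g \<in> H" and l: "l \<in> X"
  shows "berezin_transform ip k (rank_one ip g g) l = of_real ((cmod (g l))\<^sup>2 / Re (k l l))"
proof -
  define N where "N = ip_norm ip (k l)"
  have kl: "k l \<in> H"
    using l by (rule kernel_mem)
  have N2: "N\<^sup>2 = Re (k l l)"
    using ip_norm_power2[OF kl] reproducing[OF kl l] by (simp add: N_def)
  define n where "n = normalized_kernel ip k l"
  have n_eq: "n = (\<lambda>x. (1 / of_real N) * k l x)"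
    by (simp add: n_def normalized_kernel_def N_def)
  have n: "n \<in> H"
    unfolding n_eq using kl by (rule scale_mem)
  have gn: "ip g n = g l / of_real N"
    unfolding n_eq ip_scale_right[OF g kl] reproducing[OF g l] by simp
  have "berezin_transform ip k (rank_one ip g g) l = ip n g * ip g n"
    using ip_scale[OF g n]
    by (simp add: berezin_transform_def rank_one_def flip: n_def)
  also have "\<dots> = ip g n * cnj (ip g n)"
    using ip_cnj[OF g n] by simp
  also have "\<dots> = of_real ((cmod (g l / of_real N))\<^sup>2)"
    by (simp only: gn complex_norm_square)
  \<comment> \<open>For \<open>N = 0\<close> both sides are 0, by the convention for division by
    zero.\<close>
  also have "(cmod (g l / of_real N))\<^sup>2 = (cmod (g l))\<^sup>2 / Re (k l l)"
    by (simp add: norm_divide power_divide N2)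
  finally show ?thesis .
qed

end

section \<open>The disc kernel, and the identity function as a limit of its difference
  quotients\<close>

lemma disc_kernel_real:
  assumes "\<bar>a\<bar> < 1" "\<bar>b\<bar> < 1"
  shows "disc_kernel \<gamma> (of_real a) (of_real b) = of_real ((1 - a * b) powr - \<gamma>)"
proof -
  have "\<bar>a * b\<bar> < 1"
    using assms by (metis abs_mult abs_ge_zero mult_strict_mono' mult_1)
  then show ?thesis
    using assms powr_of_real[of "1 - a * b" "- \<gamma>"] by (simp add: disc_kernel_def)
qed

lemma disc_kernel_diag:
  assumes "l \<in> unit_disc"
  shows "disc_kernel \<gamma> l l = of_real ((1 - (cmod l)\<^sup>2) powr - \<gamma>)"
proof -
  have "(cmod l)\<^sup>2 \<le> 1"
    using assms by (simp add: abs_square_le_1)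
  moreover have "1 - cnj l * l = of_real (1 - (cmod l)\<^sup>2)"
    unfolding of_real_diff complex_norm_square by simp
  ultimately show ?thesis
    using assms powr_of_real[of "1 - (cmod l)\<^sup>2" "- \<gamma>"] by (simp add: disc_kernel_def)
qed

text \<open>This is a derivative at 0. It gives all inner products of the kernel quotients the same
  limit, which makes them Cauchy.\<close>

lemma kernel_quotient_tendsto:
  fixes \<gamma> :: real
  shows "((\<lambda>t. ((1 - t) powr - \<gamma> - 1) / t) \<longlongrightarrow> \<gamma>) (at 0)"
proof -
  have "((\<lambda>t. (1 - t) powr - \<gamma>) has_real_derivative \<gamma>) (at 0)"
    by (auto intro!: derivative_eq_intros)
  then show ?thesis
    by (simp add: has_field_derivative_iff)
qed

text \<open>Again a derivative at 0, now with a complex increment; it identifies the pointwise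
  values of the norm limit.\<close>

lemma complex_kernel_quotient_tendsto:
  fixes \<gamma> :: real and z :: complex
  shows "((\<lambda>h. ((1 - h * z) powr - of_real \<gamma> - 1) / h) \<longlongrightarrow> of_real \<gamma> * z) (at 0)"
proof -
  have "((\<lambda>h. (1 - h * z) powr - of_real \<gamma>) has_field_derivative of_real \<gamma> * z) (at 0)"
    by (auto intro!: derivative_eq_intros)
  then show ?thesis
    by (simp add: has_field_derivative_iff)
qed

text \<open>The kernels are the elements of \<open>H\<close> given at the outset, and
  \<open>\<gamma> * z\<close> is the derivative of the kernel in the conjugate of its parameter at
  0. Completeness places this derivative in \<open>H\<close>.\<close>

lemma disc_id_mem:
  assumes \<gamma>: "\<gamma> > 0" and "rkhs unit_disc (disc_kernel \<gamma>) H ip"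
  shows "disc_id \<in> H"
proof -
  interpret rkhs unit_disc "disc_kernel \<gamma>" H ip by fact
  define \<phi> where "\<phi> t = ((1 - t) powr - \<gamma> - 1) / t" for t :: real
  \<comment> \<open>The shift by 2 keeps every \<open>h n\<close>, including \<open>h 0\<close>,
    strictly inside the disc.\<close>
  define h where "h n = 1 / real (n + 2)" for n
  have h: "0 < h n" "h n < 1" for n
    by (auto simp: h_def)
  have h_lim: "h \<longlonglongrightarrow> 0"
    unfolding h_def using LIMSEQ_ignore_initial_segment[OF lim_1_over_n, of 2] by simp
  define D where "D n = (\<lambda>z. disc_kernel \<gamma> (of_real (h n)) z - disc_kernel \<gamma> 0 z)" for n
  define F where "F n = (\<lambda>z. (1 / of_real (h n)) * D n z)" for n
  have k: "disc_kernel \<gamma> (of_real a) \<in> H" if "\<bar>a\<bar> < 1" for a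
    using that by (simp add: kernel_mem)
  have k0: "disc_kernel \<gamma> 0 \<in> H"
    by (simp add: kernel_mem)
  have D: "D n \<in> H" for n
    unfolding D_def using h[of n] by (intro diff_mem k k0) auto
  have F: "F n \<in> H" for n
    unfolding F_def using D by (rule scale_mem)
  have ip_k: "ip (disc_kernel \<gamma> (of_real a)) (disc_kernel \<gamma> (of_real b)) =
      of_real ((1 - a * b) powr - \<gamma>)" if "\<bar>a\<bar> < 1" "\<bar>b\<bar> < 1" for a b
    using reproducing[OF k[OF that(1)], of "of_real b"] disc_kernel_real[OF that] that by simp
  \<comment> \<open>The three terms involving the kernel at 0 all equal 1, so together they
    contribute \<open>- 1 - 1 + 1 = - 1\<close>.\<close>
  have ip_D: "ip (D m) (D n) = of_real ((1 - h m * h n) powr - \<gamma> - 1)" for m n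
  proof -
    have hk: "disc_kernel \<gamma> (of_real (h i)) \<in> H" for i
      using h[of i] by (intro k) auto
    have "ip (D m) (D n) =
        ip (disc_kernel \<gamma> (of_real (h m))) (disc_kernel \<gamma> (of_real (h n)))
        - ip (disc_kernel \<gamma> (of_real (h m))) (disc_kernel \<gamma> 0)
        - (ip (disc_kernel \<gamma> 0) (disc_kernel \<gamma> (of_real (h n)))
          - ip (disc_kernel \<gamma> 0) (disc_kernel \<gamma> 0))"
      unfolding D_def using hk k0 by (simp add: ip_diff_left ip_diff_right diff_mem)
    then show ?thesis
      using ip_k[of "h m" "h n"] ip_k[of "h m" 0] ip_k[of 0 "h n"] ip_k[of 0 0] h[of m] h[of n]
      by simp
  qed
  have ip_F: "ip (F m) (F n) = of_real (\<phi> (h m * h n))" for m n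
  proof -
    have "ip (F m) (F n) = (1 / of_real (h m)) * (cnj (1 / of_real (h n)) * ip (D m) (D n))"
      using ip_scale[OF D F, of "1 / of_real (h m)" m n]
        ip_scale_right[OF D D, of m "1 / of_real (h n)" n]
      unfolding F_def by simp
    then show ?thesis
      by (simp add: ip_D \<phi>_def)
  qed
  have "\<exists>f\<in>H. (\<lambda>n. ip_norm ip (\<lambda>x. F n x - f x)) \<longlonglongrightarrow> 0"
  proof (rule complete[OF F])
    fix e :: real assume e: "e > 0"
    \<comment> \<open>The squared distance is a sum of four values of \<open>\<phi>\<close> with
      signs +, -, -, +. The limits \<gamma> cancel, leaving four errors below
      \<open>e\<^sup>2 / 4\<close> each.\<close>
    then have "e\<^sup>2 / 4 > 0"
      by simp
    then obtain d where d: "d > 0" "\<And>t. t \<noteq> 0 \<Longrightarrow> \<bar>t\<bar> < d \<Longrightarrow> \<bar>\<phi> t - \<gamma>\<bar> < e\<^sup>2 / 4"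
      using LIM_D[OF kernel_quotient_tendsto[of \<gamma>], of "e\<^sup>2 / 4"] unfolding \<phi>_def by auto
    obtain N where N: "\<And>n. n \<ge> N \<Longrightarrow> h n < d"
      using order_tendstoD(2)[OF h_lim d(1)] by (auto simp: eventually_sequentially)
    \<comment> \<open>As \<open>h n < 1\<close>, the product is at most \<open>h m\<close>, so one
      large index makes it small.\<close>
    have close: "\<bar>\<phi> (h m * h n) - \<gamma>\<bar> < e\<^sup>2 / 4" if "m \<ge> N" for m n
    proof (rule d(2))
      have "h m * h n \<le> h m"
        using h[of m] h[of n] by simp
      then have "h m * h n < d"
        using N[OF that] by linarith
      then show "\<bar>h m * h n\<bar> < d"
        using h(1)[of m] h(1)[of n] by (simp add: abs_mult)
      show "h m * h n \<noteq> 0"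
        using h[of m] h[of n] by simp
    qed
    have "ip_norm ip (\<lambda>x. F m x - F n x) < e" if mn: "m \<ge> N" "n \<ge> N" for m n
    proof -
      have "ip (\<lambda>x. F m x - F n x) (\<lambda>x. F m x - F n x) =
          ip (F m) (F m) - ip (F m) (F n) - (ip (F n) (F m) - ip (F n) (F n))"
        using F by (simp add: ip_diff_left ip_diff_right diff_mem)
      then have "(ip_norm ip (\<lambda>x. F m x - F n x))\<^sup>2 =
          \<phi> (h m * h m) - \<phi> (h m * h n) - (\<phi> (h n * h m) - \<phi> (h n * h n))"
        using ip_norm_power2[OF diff_mem[OF F F], of m n] by (simp add: ip_F)
      also have "\<dots> < e\<^sup>2"
        using close[OF mn(1), of m] close[OF mn(1), of n] close[OF mn(2), of m] close[OF mn(2), of n]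
        by linarith
      finally show ?thesis
        using e by (simp add: power2_less_imp_less)
    qed
    then show "\<exists>N. \<forall>m\<ge>N. \<forall>n\<ge>N. ip_norm ip (\<lambda>x. F m x - F n x) < e"
      by blast
  qed
  then obtain f where f: "f \<in> H" "(\<lambda>n. ip_norm ip (\<lambda>x. F n x - f x)) \<longlonglongrightarrow> 0"
    by blast
  \<comment> \<open>Two limits of \<open>F n z\<close> are compared: the one from norm convergence
    and the derivative of the kernel.\<close>
  have f_eq: "f z = of_real \<gamma> * z" if z: "z \<in> unit_disc" for z
  proof (rule LIMSEQ_unique)
    show "(\<lambda>n. F n z) \<longlonglongrightarrow> f z"
      using norm_convergence_imp_pointwise[OF F f(1) z f(2)] .
    have "filterlim (\<lambda>n. complex_of_real (h n)) (at 0) sequentially"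
    proof (rule filterlim_atI)
      show "(\<lambda>n. complex_of_real (h n)) \<longlonglongrightarrow> 0"
        using tendsto_of_real[OF h_lim, where 'a = complex] by simp
      show "\<forall>\<^sub>F n in sequentially. complex_of_real (h n) \<noteq> 0"
        using h(1) by (intro always_eventually) (simp add: less_imp_neq[symmetric])
    qed
    from filterlim_compose[OF complex_kernel_quotient_tendsto[of z \<gamma>] this]
    show "(\<lambda>n. F n z) \<longlonglongrightarrow> of_real \<gamma> * z"
      using z by (simp add: F_def D_def disc_kernel_def)
  qed
  \<comment> \<open>Equality holds off the disc as well, since both sides vanish there.\<close>
  have "disc_id = (\<lambda>z. (1 / of_real \<gamma>) * f z)"
    using f_eq vanish_outside[OF f(1)] \<gamma> by (auto simp: disc_id_def fun_eq_iff)
  then show ?thesis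
    using scale_mem[OF f(1)] by metis
qed

section \<open>The values of \<open>t * (1 - t) powr \<gamma>\<close> on
  \<open>{0..<1}\<close>\<close>

lemma mult_powr_le_max:
  fixes t \<gamma> :: real
  assumes \<gamma>: "\<gamma> > 0" and t: "0 \<le> t" "t < 1"
  shows "t * (1 - t) powr \<gamma> \<le> \<gamma> powr \<gamma> / (1 + \<gamma>) powr (1 + \<gamma>)"
proof (cases "t = 0")
  case False
  \<comment> \<open>Weighted AM-GM: \<open>u\<close> and \<open>v\<close> are \<open>t\<close> and
    \<open>1 - t\<close> rescaled to equal 1 at the maximiser, and
    \<open>u + \<gamma> * v = 1 + \<gamma>\<close>. So \<open>ln x \<le> x - 1\<close> yields
    \<open>u * v powr \<gamma> \<le> 1\<close>.\<close>
  define u v where "u = (1 + \<gamma>) * t" and "v = (1 + \<gamma>) * (1 - t) / \<gamma>"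
  have pos: "u > 0" "v > 0"
    using False \<gamma> t by (simp_all add: u_def v_def)
  have "ln (u * v powr \<gamma>) = ln u + \<gamma> * ln v"
    using pos by (simp add: ln_mult ln_powr)
  also have "\<dots> \<le> (u - 1) + \<gamma> * (v - 1)"
    using pos \<gamma> by (intro add_mono mult_left_mono ln_le_minus_one) auto
  also have "\<dots> = 0"
    using \<gamma> by (simp add: u_def v_def field_simps)
  finally have uv: "u * v powr \<gamma> \<le> 1"
    using pos by (simp add: ln_le_zero_iff)
  have "t * (1 - t) powr \<gamma> = (u / (1 + \<gamma>)) * (v * \<gamma> / (1 + \<gamma>)) powr \<gamma>"
    using \<gamma> by (simp add: u_def v_def)
  also have "\<dots> = (u * v powr \<gamma>) * (\<gamma> powr \<gamma> / (1 + \<gamma>) powr (1 + \<gamma>))"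
    using \<gamma> pos by (simp add: powr_mult powr_divide powr_add)
  also have "\<dots> \<le> 1 * (\<gamma> powr \<gamma> / (1 + \<gamma>) powr (1 + \<gamma>))"
    using uv by (intro mult_right_mono) auto
  finally show ?thesis
    by simp
qed simp

lemma mult_powr_image:
  fixes \<gamma> :: real
  assumes \<gamma>: "\<gamma> > 0"
  shows "(\<lambda>t. t * (1 - t) powr \<gamma>) ` {0..<1} = {0 .. \<gamma> powr \<gamma> / (1 + \<gamma>) powr (1 + \<gamma>)}"
    (is "?f ` _ = {0..?M}")
proof
  show "?f ` {0..<1} \<subseteq> {0..?M}"
    using mult_powr_le_max[OF \<gamma>] by auto
  \<comment> \<open>\<open>s\<close> is the maximiser; the intermediate value theorem on
    \<open>{0..s}\<close> reaches every value from 0 to the maximum.\<close>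
  define s where "s = 1 / (1 + \<gamma>)"
  have s: "0 < s" "s < 1" "1 - s = \<gamma> / (1 + \<gamma>)"
    using \<gamma> by (simp_all add: s_def field_simps)
  have fs: "?f s = ?M"
    unfolding s(3) using \<gamma> by (simp add: s_def powr_divide powr_add)
  show "{0..?M} \<subseteq> ?f ` {0..<1}"
  proof
    fix y assume y: "y \<in> {0..?M}"
    have "continuous_on {0..s} ?f"
      using s by (intro continuous_intros) auto
    then obtain t where "0 \<le> t" "t \<le> s" "?f t = y"
      using IVT'[of ?f 0 y s] y fs s(1) by auto
    then show "y \<in> ?f ` {0..<1}"
      using s(2) by force
  qed
qed

lemma cmod_power2_image_unit_disc: "(\<lambda>l. (cmod l)\<^sup>2) ` unit_disc = {0..<1}"
proof
  show "(\<lambda>l. (cmod l)\<^sup>2) ` unit_disc \<subseteq> {0..<1}"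
    by (auto simp: abs_square_less_1)
  show "{0..<1} \<subseteq> (\<lambda>l. (cmod l)\<^sup>2) ` unit_disc"
  proof
    fix t :: real assume "t \<in> {0..<1}"
    then show "t \<in> (\<lambda>l. (cmod l)\<^sup>2) ` unit_disc"
      by (intro image_eqI[of _ _ "of_real (sqrt t)"]) auto
  qed
qed

section \<open>The Berezin range and its convexity\<close>

theorem theorem3p1:
  fixes \<gamma> :: real
    and H :: "(complex \<Rightarrow> complex) set"
    and ip :: "(complex \<Rightarrow> complex) \<Rightarrow> (complex \<Rightarrow> complex) \<Rightarrow> complex"
  assumes "\<gamma> > 0"
    and "is_H_gamma \<gamma> H ip"
  shows "disc_id \<in> H \<and>
    bounded_operator_on H ip (rank_one ip disc_id disc_id) \<and>
    berezin_range unit_disc ip (disc_kernel \<gamma>) (rank_one ip disc_id disc_id)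
      = complex_of_real ` {0 .. \<gamma> powr \<gamma> / (1 + \<gamma>) powr (1 + \<gamma>)} \<and>
    convex (berezin_range unit_disc ip (disc_kernel \<gamma>) (rank_one ip disc_id disc_id))"
proof -
  have R: "rkhs unit_disc (disc_kernel \<gamma>) H ip"
    using assms(2) by (simp add: is_H_gamma_def)
  interpret rkhs unit_disc "disc_kernel \<gamma>" H ip by (rule R)
  have mem: "disc_id \<in> H"
    using disc_id_mem[OF assms(1) R] .
  have "berezin_transform ip (disc_kernel \<gamma>) (rank_one ip disc_id disc_id) l =
      complex_of_real ((cmod l)\<^sup>2 * (1 - (cmod l)\<^sup>2) powr \<gamma>)" if l: "l \<in> unit_disc" for l
    using l unfolding berezin_transform_rank_one[OF mem l] disc_kernel_diag[OF l]
    by (simp add: disc_id_def powr_minus field_simps)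
  then have "berezin_range unit_disc ip (disc_kernel \<gamma>) (rank_one ip disc_id disc_id) =
      (\<lambda>l. complex_of_real ((cmod l)\<^sup>2 * (1 - (cmod l)\<^sup>2) powr \<gamma>)) ` unit_disc"
    unfolding berezin_range_def by (rule image_cong[OF refl])
  \<comment> \<open>The transform depends on \<open>l\<close> only through the squared modulus,
    which runs over \<open>{0..<1}\<close>; this reduces the range to a real image.\<close>
  also have "\<dots> = complex_of_real ` (\<lambda>t. t * (1 - t) powr \<gamma>) ` (\<lambda>l. (cmod l)\<^sup>2) ` unit_disc"
    by (simp add: image_image)
  also have "\<dots> = complex_of_real ` {0 .. \<gamma> powr \<gamma> / (1 + \<gamma>) powr (1 + \<gamma>)}"
    by (simp only: cmod_power2_image_unit_disc mult_powr_image[OF assms(1)])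
  finally have range: "berezin_range unit_disc ip (disc_kernel \<gamma>) (rank_one ip disc_id disc_id) =
      complex_of_real ` {0 .. \<gamma> powr \<gamma> / (1 + \<gamma>) powr (1 + \<gamma>)}" .
  have "convex (complex_of_real ` {0 .. \<gamma> powr \<gamma> / (1 + \<gamma>) powr (1 + \<gamma>)})"
    by (intro convex_linear_image bounded_linear.linear bounded_linear_of_real) simp
  then show ?thesis
    using mem bounded_operator_rank_one[OF mem mem] range by simp
qed

end
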